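(* If $T$ is a tree of order $n$ and leaf order $\ell$, then $$\iota(T) \leq \frac{n+\ell}{4}.$$ Moreover, for any integer $r \geq 1$, there exist two integers $n$ and $\ell$, and a tree $T$ of order $n$ and leaf order $\ell$, such that $\iota(T) = \frac{n + \ell}{4} = r$.
   Context: Graphs are finite and simple. A leaf is a vertex of degree $1$; the leaf order is the number of leaves; the order is the number of vertices. For $D\subseteq V(G)$, $N[D]$ is the set consisting of the vertices of $D$ and all their neighbours. An isolating set of $G$ is a set $D\subseteq V(G)$ (possibly empty) such that $G-N[D]$ has no edges. The isolation number $\iota(G)$ is the size of a smallest isolating set of $G$. *)

theory Defs
  imports Complex_Main "Graph_Theory.Digraph_Component"
begin

text \<open>
  Finite simple graphs are the \<^locale>\<open>pair_graph\<close>s of the entry Graph_Theory: an edge \<open>uv\<close> is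
  represented by the two arcs \<open>(u, v)\<close> and \<open>(v, u)\<close>.
\<close>

text \<open>
  In such a representation every edge traversed back and forth is a \<^const>\<open>pre_digraph.cycle\<close> of
  length 2, so that \<^const>\<open>Digraph_Component.tree\<close> only holds of the one-vertex graph. The cycles of
  the undirected graph are those of length at least 3. Connectedness includes that there is at
  least one vertex.
\<close>

definition tree_graph :: "'a pair_pre_digraph \<Rightarrow> bool" where
  "tree_graph G \<longleftrightarrow> pair_graph G \<and> Digraph_Component.connected (with_proj G) \<and>
     \<not> (\<exists>p. pre_digraph.cycle (with_proj G) p \<and> length p \<ge> 3)"

definition graph_order :: "'a pair_pre_digraph \<Rightarrow> nat" where
  "graph_order G = card (pverts G)"

definition leaves :: "'a pair_pre_digraph \<Rightarrow> 'a set" where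
  "leaves G = {v \<in> pverts G. out_degree (with_proj G) v = 1}"

definition leaf_order :: "'a pair_pre_digraph \<Rightarrow> nat" where
  "leaf_order G = card (leaves G)"

definition closed_nbhd :: "'a pair_pre_digraph \<Rightarrow> 'a set \<Rightarrow> 'a set" where
  "closed_nbhd G D = D \<union> {v. \<exists>u\<in>D. u \<rightarrow>\<^bsub>with_proj G\<^esub> v}"

definition isolating_set :: "'a pair_pre_digraph \<Rightarrow> 'a set \<Rightarrow> bool" where
  "isolating_set G D \<longleftrightarrow> D \<subseteq> pverts G \<and>
     arcs (with_proj G \<restriction> (pverts G - closed_nbhd G D)) = {}"

definition isolation_number :: "'a pair_pre_digraph \<Rightarrow> nat" where
  "isolation_number G = (LEAST k. \<exists>D. isolating_set G D \<and> card D = k)"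

end

theory Submission
  imports Defs
begin

text \<open>
  A tree with at least two vertices is rooted at one of its leaves \<open>r\<close>, and every vertex receives one
  of four labels, determined from the leaves upwards. A vertex with an \<open>Open\<close> child is \<open>Chosen\<close>;
  otherwise, with a \<open>Chosen\<close> child, it is \<open>Dominated\<close>; otherwise, with a \<open>Free\<close> child, it is \<open>Open\<close>;
  otherwise it is \<open>Free\<close>. An \<open>Open\<close> vertex is thus the upper end of an edge that still has to be
  hit, and this is left to its parent. Hence the chosen vertices, together with the root if it
  is \<open>Open\<close>, form an isolating set (\<open>labelling_isolates\<close>).

  The size of this set is bounded by a charging argument. Each vertex receives one unit, each
  childless vertex a second one, and each vertex hands the credit \<open>0\<close>, \<open>1\<close>, \<open>2\<close> or \<open>3\<close> of its label
  (\<open>Chosen\<close>, \<open>Dominated\<close>, \<open>Free\<close>, \<open>Open\<close>) to its parent. The labelling rules are such that every vertex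
  can pay its own credit and, if it is chosen, four more units (\<open>label_from_pays\<close>). Summing over
  all vertices, four times the number of chosen vertices plus the credit of the root is at most \<open>n\<close>
  plus the number of childless vertices (\<open>labelling_bound\<close>). An \<open>Open\<close> root has credit \<open>3\<close>, one
  short of the price of choosing it. The missing unit is there because the root is itself a leaf,
  and so the tree has at least one leaf more than it has childless vertices.

  The rooted structure is obtained by growing a connected vertex set from \<open>r\<close>, one vertex at a time:
  a new vertex with two neighbours in the set would close a cycle (\<open>unique_attachment\<close>).

  The bound is attained by the path on \<open>4 * k + 2\<close> vertices. A vertex \<open>v\<close> of an isolating set handles
  only edges that meet the closed neighbourhood of \<open>v\<close>. There are at most four of these, and the path
  has \<open>4 * k + 1\<close> edges, which makes \<open>k + 1\<close> vertices necessary. They suffice by the general bound, since the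
  path has two leaves.
\<close>

section \<open>Rooted structure of trees\<close>

text \<open>
  The rank \<open>d\<close> need not be the distance from the root; strict growth along parents is what excludes
  cycles of parents and permits recursion over children. The set \<open>S\<close> is a parameter because the
  structure is built up along an increasing chain of vertex sets.
\<close>

definition rooted_on :: "'a pair_pre_digraph \<Rightarrow> 'a set \<Rightarrow> 'a \<Rightarrow> ('a \<Rightarrow> 'a) \<Rightarrow> ('a \<Rightarrow> nat) \<Rightarrow> bool" where
  "rooted_on G S r par d \<longleftrightarrow> r \<in> S \<and> (\<forall>v\<in>S - {r}. par v \<in> S \<and> d (par v) < d v) \<and>
     (\<forall>u\<in>S. \<forall>v\<in>S. (u, v) \<in> parcs G \<longleftrightarrow> (u \<noteq> r \<and> v = par u) \<or> (v \<noteq> r \<and> u = par v))"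

definition children :: "'a pair_pre_digraph \<Rightarrow> 'a \<Rightarrow> ('a \<Rightarrow> 'a) \<Rightarrow> 'a \<Rightarrow> 'a set" where
  "children G r par v = {c. c \<in> pverts G - {r} \<and> par c = v}"

definition linked :: "'a pair_pre_digraph \<Rightarrow> 'a set \<Rightarrow> bool" where
  "linked G S \<longleftrightarrow> (\<forall>x\<in>S. \<forall>y\<in>S. \<exists>p. pre_digraph.awalk (with_proj G) x p y \<and> set (pawalk_verts x p) \<subseteq> S)"

text \<open>The tails and the heads of the arcs of a walk are two views of the same vertex sequence.\<close>

lemma pcas_map_fst_snd: "pcas u p v \<Longrightarrow> map fst p @ [v] = u # map snd p"
  by (induction p arbitrary: u) auto

lemma set_pawalk_verts: "pcas u p v \<Longrightarrow> set (pawalk_verts u p) = insert u (snd ` set p)"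
  by (induction p arbitrary: u) auto

context pair_graph
begin

lemma outside_edge:
  assumes "connected (with_proj G)" "S \<subseteq> pverts G" "S \<noteq> {}" "S \<noteq> pverts G"
  obtains u w where "u \<in> S" "w \<in> pverts G - S" "(u, w) \<in> parcs G"
proof -
  obtain x y where x: "x \<in> S" and y: "y \<in> pverts G - S" using assms by blast
  have "strongly_connected (with_proj G)"
    using assms(1) symmetric_connected_imp_strongly_connected sym_arcs by blast
  then obtain p where p: "awalk x p y"
    using x y assms(2) reachable_awalk[of x y] unfolding strongly_connected_def with_proj_simps
    by (meson DiffD1 subsetD)
  have "awalk x p y \<Longrightarrow> x \<in> S \<Longrightarrow> \<exists>u w. u \<in> S \<and> w \<in> pverts G - S \<and> (u, w) \<in> parcs G" for x p
  proof (induction p arbitrary: x)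
    case Nil
    then show ?case using y by (simp add: awalk_Nil_iff)
  next
    case (Cons e p)
    then have e: "e \<in> parcs G" "fst e = x" "awalk (snd e) p y"
      by (auto simp: awalk_Cons_iff)
    show ?case
    proof (cases "snd e \<in> S")
      case True
      then show ?thesis using Cons.IH e by blast
    next
      case False
      then show ?thesis using Cons.prems(2) e arc_snd_in_verts[OF e(1)]
        by (metis DiffI prod.collapse)
    qed
  qed
  with p x that show thesis by blast
qed

text \<open>Shortcutting a walk only drops arcs, so it does not leave the set.\<close>

lemma linked_path:
  assumes "linked G S" "x \<in> S" "y \<in> S"
  obtains p where "apath x p y" "set (pawalk_verts x p) \<subseteq> S"
proof -
  obtain p where p: "awalk x p y" "set (pawalk_verts x p) \<subseteq> S"
    using assms unfolding linked_def by blast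
  have q: "apath x (awalk_to_apath p) y" by (rule apath_awalk_to_apath[OF p(1)])
  have "set (awalk_to_apath p) \<subseteq> set p" by (rule awalk_to_apath_subset[OF p(1)])
  moreover have "pcas x p y" "pcas x (awalk_to_apath p) y"
    using p(1) q by (auto simp: apath_def awalk_def)
  ultimately have "set (pawalk_verts x (awalk_to_apath p)) \<subseteq> S"
    using p(2) by (auto simp: set_pawalk_verts)
  with q that show thesis by blast
qed

lemma linked_insert:
  assumes "linked G S" "u \<in> S" "w \<in> pverts G" "(u, w) \<in> parcs G"
  shows "linked G (insert w S)"
proof -
  have wu: "(w, u) \<in> parcs G" using assms(4) arcs_symmetric by blast
  have 1: "\<exists>p. awalk x p y \<and> set (pawalk_verts x p) \<subseteq> insert w S" if "x \<in> S" "y \<in> S" for x y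
    using assms(1) that by (fastforce simp: linked_def)
  have 2: "\<exists>p. awalk w p y \<and> set (pawalk_verts w p) \<subseteq> insert w S" if y: "y \<in> S" for y
  proof -
    obtain p where "awalk u p y" "set (pawalk_verts u p) \<subseteq> insert w S"
      using 1[OF assms(2) y] by blast
    then show ?thesis using wu by (intro exI[of _ "(w, u) # p"]) (auto simp: awalk_Cons_iff)
  qed
  have 3: "\<exists>p. awalk x p w \<and> set (pawalk_verts x p) \<subseteq> insert w S" if x: "x \<in> S" for x
  proof -
    obtain p where p: "awalk x p u" "set (pawalk_verts x p) \<subseteq> insert w S"
      using 1 x assms(2) by blast
    have uw: "awalk u [(u, w)] w"
      using assms(3,4) by (auto simp: awalk_Cons_iff awalk_Nil_iff)
    have "awalk x (p @ [(u, w)]) w" by (rule awalk_appendI[OF p(1) uw])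
    moreover from p(1) calculation have "pcas x p u" "pcas x (p @ [(u, w)]) w"
      by (auto simp: awalk_def)
    then have "set (pawalk_verts x (p @ [(u, w)])) \<subseteq> insert w S"
      using p(2) by (simp only: set_pawalk_verts) auto
    ultimately show ?thesis by blast
  qed
  have 4: "\<exists>p. awalk w p w \<and> set (pawalk_verts w p) \<subseteq> insert w S"
    using assms(3) by (intro exI[of _ "[]"]) (auto simp: awalk_Nil_iff)
  show ?thesis using 1 2 3 4 unfolding linked_def by blast
qed

text \<open>
  A path inside \<open>S\<close> between two distinct neighbours of the outside vertex \<open>w\<close> is closed by \<open>w\<close> to a
  cycle, which is too long to be an edge traversed back and forth.
\<close>

lemma unique_attachment:
  assumes acyclic: "\<not> (\<exists>p. cycle p \<and> length p \<ge> 3)"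
    and S: "linked G S" "w \<notin> S"
    and u: "u \<in> S" "(u, w) \<in> parcs G" and v: "v \<in> S" "(v, w) \<in> parcs G"
  shows "u = v"
proof (rule ccontr)
  assume "u \<noteq> v"
  obtain p where p: "apath u p v" "set (pawalk_verts u p) \<subseteq> S"
    using linked_path[OF S(1) u(1) v(1)] by blast
  have wu: "(w, u) \<in> parcs G" using u(2) arcs_symmetric by blast
  have vw: "awalk v [(v, w)] w"
    using v(2) in_arcsD2 by (auto simp: awalk_Cons_iff awalk_Nil_iff)
  have pw: "awalk u p v" and pd: "distinct (pawalk_verts u p)" using p(1) by (auto simp: apath_def)
  have aw: "awalk u (p @ [(v, w)]) w"
    by (rule awalk_appendI[OF pw vw])
  have "pawalk_verts u (p @ [(v, w)]) = pawalk_verts u p @ [w]"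
    using awalk_verts_append[OF aw] pw by (auto simp: awalk_def)
  then have "distinct (pawalk_verts u (p @ [(v, w)]))"
    using pd p(2) S(2) by auto
  moreover have "awalk w ((w, u) # p @ [(v, w)]) w"
    using aw wu by (simp only: awalk_Cons_iff fst_conv snd_conv)
  ultimately have "cycle ((w, u) # p @ [(v, w)])"
    unfolding cycle_def by (intro exI[of _ w]) auto
  moreover have "p \<noteq> []" using \<open>u \<noteq> v\<close> pw by (auto simp: awalk_Nil_iff)
  then have "length ((w, u) # p @ [(v, w)]) \<ge> 3" by (cases p) auto
  ultimately show False using acyclic by blast
qed

text \<open>
  The new vertex hangs below its only neighbour \<open>u\<close>. Its rank \<open>k\<close> exceeds all earlier ranks, in
  particular that of \<open>u\<close>.
\<close>

lemma rooted_on_insert: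
  assumes R: "rooted_on G S r par d" and bound: "\<And>v. v \<in> S \<Longrightarrow> d v < k"
    and w: "w \<notin> S" and u: "u \<in> S" "(u, w) \<in> parcs G"
    and uniq: "\<And>v. v \<in> S \<Longrightarrow> (v, w) \<in> parcs G \<Longrightarrow> v = u"
  shows "rooted_on G (insert w S) r (par(w := u)) (d(w := k))"
proof -
  have sym: "(a, b) \<in> parcs G \<longleftrightarrow> (b, a) \<in> parcs G" for a b using arcs_symmetric by blast
  have loop: "(w, w) \<notin> parcs G" using no_loops' by blast
  have nbr: "v \<in> S \<Longrightarrow> (v, w) \<in> parcs G \<longleftrightarrow> v = u" "v \<in> S \<Longrightarrow> (w, v) \<in> parcs G \<longleftrightarrow> v = u" for v
    using uniq u sym by blast+
  have r: "r \<in> S" "r \<noteq> w" using R w by (auto simp: rooted_on_def)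
  have par: "par v \<in> S" "d (par v) < d v" if "v \<in> S" "v \<noteq> r" for v
    using R that by (auto simp: rooted_on_def)
  have arc: "(x, y) \<in> parcs G \<longleftrightarrow> (x \<noteq> r \<and> y = par x) \<or> (y \<noteq> r \<and> x = par y)"
    if "x \<in> S" "y \<in> S" for x y
    using R that by (auto simp: rooted_on_def)
  have parw: "par v \<noteq> w" if "v \<in> S" "v \<noteq> r" for v using par that w by blast
  show ?thesis unfolding rooted_on_def
  proof (intro conjI ballI)
    show "r \<in> insert w S" using r by simp
  next
    fix v assume v: "v \<in> insert w S - {r}"
    show "(par(w := u)) v \<in> insert w S" using v par u by auto
    show "(d(w := k)) ((par(w := u)) v) < (d(w := k)) v"
      using v par parw u w bound by auto
  next
    fix x y assume xy: "x \<in> insert w S" "y \<in> insert w S"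
    consider "x \<in> S" "y \<in> S" | "x = w" "y = w" | "x = w" "y \<in> S" | "x \<in> S" "y = w" using xy by blast
    then show "((x, y) \<in> parcs G) = (x \<noteq> r \<and> y = (par(w := u)) x \<or> y \<noteq> r \<and> x = (par(w := u)) y)"
    proof cases
      case 1 then have "x \<noteq> w" "y \<noteq> w" using w by blast+
      then show ?thesis using arc 1 by simp
    next
      case 2 then show ?thesis using loop u w by auto
    next
      case 3 then have "y \<noteq> w" using w by blast
      then show ?thesis using nbr 3 r parw by auto
    next
      case 4 then have "x \<noteq> w" using w by blast
      then show ?thesis using nbr 4 r parw by auto
    qed
  qed
qed

text \<open>
  Ranks are the times of insertion. Connectedness provides an edge leaving any set that is not yet
  everything, so the growth stops only at the whole vertex set.
\<close>

lemma acyclic_connected_imp_rooted: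
  assumes conn: "connected (with_proj G)" and acyclic: "\<not> (\<exists>p. cycle p \<and> length p \<ge> 3)"
    and r: "r \<in> pverts G"
  shows "\<exists>par d. rooted_on G (pverts G) r par d"
proof -
  have "\<exists>S par d. S \<subseteq> pverts G \<and> card S = Suc k \<and> linked G S \<and> rooted_on G S r par d \<and>
      (\<forall>v\<in>S. d v < Suc k)" if "k < card (pverts G)" for k
    using that
  proof (induction k)
    case 0
    have "rooted_on G {r} r par (\<lambda>_. 0)" for par using no_loops' by (auto simp: rooted_on_def)
    moreover have "linked G {r}" unfolding linked_def using r
      by (auto simp: awalk_Nil_iff intro!: exI[of _ "[]"])
    ultimately show ?case using r by (intro exI[of _ "{r}"]) auto
  next
    case (Suc k)
    then obtain S par d where S: "S \<subseteq> pverts G" "card S = Suc k" "linked G S"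
      "rooted_on G S r par d" "\<forall>v\<in>S. d v < Suc k" by auto
    then have "S \<noteq> {}" "S \<noteq> pverts G" using Suc.prems by auto
    then obtain u w where uw: "u \<in> S" "w \<in> pverts G - S" "(u, w) \<in> parcs G"
      using outside_edge[OF conn S(1)] by blast
    have "rooted_on G (insert w S) r (par(w := u)) (d(w := Suc k))"
      using S uw unique_attachment[OF acyclic S(3)] by (intro rooted_on_insert) auto
    moreover have "linked G (insert w S)" using linked_insert S uw by blast
    moreover have "card (insert w S) = Suc (Suc k)"
      using S uw finite_subset[OF S(1)] by simp
    moreover have "insert w S \<subseteq> pverts G" using S uw by blast
    moreover have "\<forall>v\<in>insert w S. (d(w := Suc k)) v < Suc (Suc k)" using S by auto
    ultimately show ?case by blast
  qed
  moreover have "card (pverts G) > 0" using r by (auto simp: card_gt_0_iff)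
  ultimately obtain S par d where "S \<subseteq> pverts G" "card S = card (pverts G)" "rooted_on G S r par d"
    by (metis Suc_pred' diff_less zero_less_one)
  then show ?thesis using card_subset_eq by (metis finite_verts)
qed

text \<open>
  Of the vertices of a cycle take one of maximal rank. Both its neighbours on the cycle have to be
  its parent, so they coincide, which leaves room only for an edge traversed back and forth.
\<close>

lemma rooted_imp_no_long_cycle:
  assumes R: "rooted_on G (pverts G) r par d" and cyc: "cycle p"
  shows "length p < 3"
proof (rule ccontr)
  assume "\<not> length p < 3"
  then have n: "length p \<ge> 3" by simp
  obtain u where u: "pcas u p u" "set p \<subseteq> parcs G" "distinct (tl (pawalk_verts u p))"
    using cyc by (auto simp: cycle_def awalk_def)
  let ?x = "\<lambda>i. fst (p ! i)" and ?n = "length p"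
  have p: "p \<noteq> []" using n by auto
  have eq: "map fst p @ [u] = u # map snd p" by (rule pcas_map_fst_snd[OF u(1)])
  have rot: "map snd p = rotate1 (map fst p)"
    using eq p by (cases p) auto
  have "tl (pawalk_verts u p) = map snd p"
  proof -
    have "pcas u p v \<Longrightarrow> pawalk_verts u p = u # map snd p" for u v
      by (induction p arbitrary: u) auto
    then show ?thesis using u(1) by simp
  qed
  then have dist: "distinct (map fst p)" using u(3) rot by simp
  have snd_eq: "snd (p ! i) = ?x (Suc i mod ?n)" if "i < ?n" for i
  proof -
    have "snd (p ! i) = map snd p ! i" using that by simp
    also have "\<dots> = ?x (Suc i mod ?n)"
      using that p unfolding rot by (simp add: nth_rotate1)
    finally show ?thesis .
  qed
  have arc: "(?x i, ?x (Suc i mod ?n)) \<in> parcs G" if "i < ?n" for i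
    using u(2) snd_eq[OF that] nth_mem[OF that] by (metis prod.collapse subsetD)
  have lower: "y = par x" if "(x, y) \<in> parcs G \<or> (y, x) \<in> parcs G" "d y \<le> d x" for x y
  proof -
    have V: "x \<in> pverts G" "y \<in> pverts G" using that(1) in_arcsD1 in_arcsD2 by blast+
    with R that(1) have "(x \<noteq> r \<and> y = par x) \<or> (y \<noteq> r \<and> x = par y)"
      by (auto simp: rooted_on_def)
    moreover have "d (par y) < d y" if "y \<noteq> r" using R V that by (auto simp: rooted_on_def)
    ultimately show ?thesis using that(2) by auto
  qed
  obtain m where m: "m < ?n" "\<And>i. i < ?n \<Longrightarrow> d (?x i) \<le> d (?x m)"
  proof -
    let ?M = "Max ((\<lambda>i. d (?x i)) ` {..<?n})"
    have "?M \<in> (\<lambda>i. d (?x i)) ` {..<?n}" using p by (intro Max_in) auto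
    then obtain m where "m < ?n" "?M = d (?x m)" by auto
    moreover have "d (?x i) \<le> ?M" if "i < ?n" for i using that by (intro Max_ge) auto
    ultimately show thesis using that by metis
  qed
  \<comment> \<open>\<open>l\<close> is the cyclic predecessor of \<open>m\<close>.\<close>
  define l where "l = (if m = 0 then ?n - 1 else m - 1)"
  have l: "l < ?n" "Suc l mod ?n = m" using m(1) n by (auto simp: l_def)
  have s: "Suc m mod ?n < ?n" using p by simp
  have "?x (Suc m mod ?n) = par (?x m)" using arc[OF m(1)] m(2)[OF s] lower by blast
  moreover have "?x l = par (?x m)" using arc[OF l(1)] m(2)[OF l(1)] lower l(2) by metis
  ultimately have "map fst p ! (Suc m mod ?n) = map fst p ! l" using s l by simp
  then have "Suc m mod ?n = l" using nth_eq_iff_index_eq[OF dist, of "Suc m mod ?n" l] s l(1) by simp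
  then show False using n m(1) by (auto simp: l_def mod_Suc split: if_splits)
qed

lemma rooted_imp_tree:
  assumes R: "rooted_on G (pverts G) r par d"
  shows "tree_graph G"
proof -
  have r: "r \<in> pverts G" using R by (simp add: rooted_on_def)
  have up: "v \<rightarrow>\<^sup>*\<^bsub>with_proj G\<^esub> r" if "v \<in> pverts G" for v
    using that
  proof (induction "d v" arbitrary: v rule: less_induct)
    case less
    show ?case
    proof (cases "v = r")
      case False
      then have "par v \<in> pverts G" "d (par v) < d v" "(v, par v) \<in> parcs G"
        using R less.prems by (auto simp: rooted_on_def)
      then show ?thesis using less.hyps adj_reachable_trans by blast
    qed (use less.prems in auto)
  qed
  have "u \<rightarrow>\<^sup>*\<^bsub>with_proj G\<^esub> v" if "u \<in> pverts G" "v \<in> pverts G" for u v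
    using up that symmetric_reachable[OF sym_arcs] reachable_trans by metis
  then have "connected (with_proj G)"
    using r reachable_mk_symmetric_eq[OF sym_arcs] by (intro connectedI) auto
  then show ?thesis using rooted_imp_no_long_cycle[OF R] pair_graph by (force simp: tree_graph_def)
qed

end


section \<open>Labels and credits\<close>

text \<open>
  A \<open>Dominated\<close> vertex has a chosen child, a \<open>Free\<close> vertex has only
  dominated children, and an \<open>Open\<close> vertex has a \<open>Free\<close> child but no chosen one, so that the edge
  between the two is still to be hit.
\<close>

datatype label = Chosen | Dominated | Free | Open

fun credit :: "label \<Rightarrow> nat" where
  "credit Chosen = 0"
| "credit Dominated = 1"
| "credit Free = 2"
| "credit Open = 3"

definition label_from :: "label set \<Rightarrow> label" where
  "label_from X = (if Open \<in> X then Chosen else if Chosen \<in> X then Dominated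
     else if Free \<in> X then Open else Free)"

definition chosen :: "'a pair_pre_digraph \<Rightarrow> ('a \<Rightarrow> label) \<Rightarrow> 'a set" where
  "chosen G s = {v \<in> pverts G. s v = Chosen}"

text \<open>
  This is where the credits come from. An \<open>Open\<close> child brings \<open>3\<close>, which together with the unit of
  the vertex is the price \<open>4\<close> of choosing it. A \<open>Dominated\<close> vertex passes on its own unit, and an \<open>Open\<close>
  vertex adds it to the \<open>2\<close> of a \<open>Free\<close> child. A \<open>Free\<close> vertex either is childless and has two units,
  or adds its unit to that of a \<open>Dominated\<close> child.
\<close>

lemma label_from_pays:
  assumes "finite C"
  shows "credit (label_from (s ` C)) + (if label_from (s ` C) = Chosen then 4 else 0)
    \<le> 1 + (if C = {} then 1 else 0) + (\<Sum>c\<in>C. credit (s c))"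
proof -
  have ge: "credit (s c) \<le> (\<Sum>c\<in>C. credit (s c))" if "c \<in> C" for c
    using assms that by (intro member_le_sum) auto
  consider "Open \<in> s ` C" | "Open \<notin> s ` C" "Chosen \<in> s ` C"
    | "Open \<notin> s ` C" "Chosen \<notin> s ` C" "Free \<in> s ` C"
    | "Open \<notin> s ` C" "Chosen \<notin> s ` C" "Free \<notin> s ` C" by blast
  then show ?thesis
  proof cases
    case 1 then show ?thesis using ge by (fastforce simp: label_from_def)
  next
    case 2 then show ?thesis by (simp add: label_from_def)
  next
    case 3 then show ?thesis using ge by (fastforce simp: label_from_def)
  next
    case 4
    show ?thesis
    proof (cases "C = {}")
      case False
      then obtain c where c: "c \<in> C" by blast
      then have "s c = Dominated" using 4 by (cases "s c") (auto simp: image_iff)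
      then show ?thesis using ge[OF c] 4 by (simp add: label_from_def)
    qed (simp add: label_from_def)
  qed
qed

section \<open>The upper bound\<close>

locale rooted_tree = pair_graph T for T :: "'a pair_pre_digraph" +
  fixes r :: 'a and par :: "'a \<Rightarrow> 'a" and d :: "'a \<Rightarrow> nat"
  assumes rooted: "rooted_on T (pverts T) r par d"
begin

abbreviation "ch \<equiv> children T r par"

lemma root: "r \<in> pverts T"
  using rooted by (simp add: rooted_on_def)

lemma par: "par v \<in> pverts T" "d (par v) < d v" if "v \<in> pverts T" "v \<noteq> r"
  using rooted that by (auto simp: rooted_on_def)

lemma arc_cases:
  "(u, v) \<in> parcs T \<longleftrightarrow> (u \<in> pverts T \<and> u \<noteq> r \<and> v = par u) \<or> (v \<in> pverts T \<and> v \<noteq> r \<and> u = par v)"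
  using rooted wellformed' unfolding rooted_on_def by (metis DiffI singletonD)

lemma finite_children: "finite (ch v)"
  by (simp add: children_def pair_finite_verts)

text \<open>Recursion from the vertices of high rank down to the root.\<close>

lemma labelling_exists: "\<exists>s. \<forall>v. s v = label_from (s ` ch v)"
proof -
  let ?R = "{(c, v). c \<in> ch v}"
  let ?F = "\<lambda>f v. label_from (f ` ch v)"
  have "?R \<subseteq> (measure d)\<inverse>" using par by (auto simp: children_def)
  moreover have "finite ?R"
  proof (rule finite_subset)
    show "?R \<subseteq> pverts T \<times> pverts T" using par by (auto simp: children_def)
  qed (simp add: pair_finite_verts)
  moreover have "acyclic ?R"
  proof -
    have "acyclic ((measure d)\<inverse>)" by (simp add: acyclic_converse wf_acyclic)
    then show ?thesis using calculation(1) acyclic_subset by blast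
  qed
  ultimately have "wf ?R" using finite_acyclic_wf by blast
  moreover have "adm_wf ?R ?F"
    unfolding adm_wf_def by (auto intro!: arg_cong[where f = label_from])
  ultimately have "wfrec ?R ?F = ?F (wfrec ?R ?F)" by (rule wfrec_fixpoint)
  then show ?thesis by metis
qed

text \<open>
  In the sum of the local inequalities each credit, except that of the root, occurs once as
  received by the parent and once as paid by the vertex, and cancels.
\<close>

lemma labelling_bound:
  assumes s: "\<And>v. s v = label_from (s ` ch v)"
  shows "4 * card (chosen T s) + credit (s r)
    \<le> card (pverts T) + card {v \<in> pverts T. ch v = {}}"
proof -
  let ?V = "pverts T"
  have fin: "finite ?V" by (rule pair_finite_verts)
  have indicator: "(\<Sum>v\<in>?V. if P v then k else 0) = k * card {v \<in> ?V. P v}" for P and k :: nat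
    using fin by (simp add: sum.If_cases Int_def mult.commute)
  have "(\<Sum>v\<in>?V. credit (s v)) + 4 * card (chosen T s)
      = (\<Sum>v\<in>?V. credit (s v) + (if s v = Chosen then 4 else 0))"
    by (simp add: sum.distrib indicator chosen_def)
  also have "\<dots> \<le> (\<Sum>v\<in>?V. 1 + (if ch v = {} then 1 else 0) + (\<Sum>c\<in>ch v. credit (s c)))"
  proof (rule sum_mono)
    fix v
    show "credit (s v) + (if s v = Chosen then 4 else 0)
      \<le> 1 + (if ch v = {} then 1 else 0) + (\<Sum>c\<in>ch v. credit (s c))"
      using label_from_pays[OF finite_children[of v], of s] unfolding s[of v, symmetric] .
  qed
  also have "\<dots> = card ?V + card {v \<in> ?V. ch v = {}} + (\<Sum>v\<in>?V. \<Sum>c\<in>ch v. credit (s c))"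
    by (simp only: sum.distrib indicator) simp
  also have "(\<Sum>v\<in>?V. \<Sum>c\<in>ch v. credit (s c)) = (\<Sum>c\<in>?V - {r}. credit (s c))"
    unfolding children_def using fin par by (intro sum.group) auto
  also have "(\<Sum>v\<in>?V. credit (s v)) = credit (s r) + (\<Sum>c\<in>?V - {r}. credit (s c))"
    using fin root by (rule sum.remove)
  finally show ?thesis by linarith
qed

text \<open>
  Chosen and \<open>Dominated\<close> vertices lie in the closed neighbourhood of the set, and so do the \<open>Open\<close> ones:
  the parent of an \<open>Open\<close> vertex is chosen, and an \<open>Open\<close> root is in the set itself. So an edge that is
  not hit joins two \<open>Free\<close> vertices, but the parent of a \<open>Free\<close> vertex is never \<open>Free\<close>.
\<close>

lemma labelling_isolates:
  assumes s: "\<And>v. s v = label_from (s ` ch v)"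
  shows "isolating_set T (if s r = Open then insert r (chosen T s) else chosen T s)"
proof -
  define D where "D = (if s r = Open then insert r (chosen T s) else chosen T s)"
  let ?N = "closed_nbhd T D"
  have sub: "D \<subseteq> pverts T" using root by (auto simp: D_def chosen_def)
  have nbr: "v \<in> ?N" if "u \<in> D" "(u, v) \<in> parcs T" for u v
    using that unfolding closed_nbhd_def by auto
  have C: "v \<in> D" if "v \<in> pverts T" "s v = Chosen" for v using that by (auto simp: D_def chosen_def)
  have self: "v \<in> ?N" if "v \<in> D" for v using that unfolding closed_nbhd_def by auto
  have up: "s (par v) = label_from (s ` ch (par v))" "s v \<in> s ` ch (par v)"
    if "v \<in> pverts T" "v \<noteq> r" for v
    using s[of "par v"] that by (auto simp: children_def)
  have dom: "v \<in> ?N" if v: "v \<in> pverts T" "s v = Dominated" for v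
  proof -
    have "label_from (s ` ch v) = Dominated" using s[of v] v(2) by metis
    then have "Chosen \<in> s ` ch v" by (simp add: label_from_def split: if_splits)
    then obtain c where "c \<in> pverts T" "c \<noteq> r" "par c = v" "s c = Chosen"
      by (auto simp: children_def)
    then show ?thesis using nbr[OF C, of c v] arc_cases by blast
  qed
  have opn: "v \<in> ?N" if v: "v \<in> pverts T" "s v = Open" for v
  proof (cases "v = r")
    case True
    then show ?thesis using v self by (simp add: D_def)
  next
    case False
    then have "Open \<in> s ` ch (par v)" using up(2)[of v] v by metis
    then have "s (par v) = Chosen" using up(1)[of v] v(1) False by (metis label_from_def)
    then show ?thesis using nbr[OF C, of "par v" v] arc_cases par v False by blast
  qed
  have edge: "v \<in> ?N \<or> par v \<in> ?N" if v: "v \<in> pverts T" "v \<noteq> r" for v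
  proof (cases "s v")
    case Free
    then have "Free \<in> s ` ch (par v)" using up(2)[OF v] by metis
    then have "label_from (s ` ch (par v)) \<noteq> Free" by (simp add: label_from_def)
    then have "s (par v) \<noteq> Free" using up(1)[OF v] by metis
    then show ?thesis using dom opn self C par(1)[OF v] by (cases "s (par v)") blast+
  qed (use dom opn self C v in blast)+
  have "u \<in> ?N \<or> v \<in> ?N" if "(u, v) \<in> parcs T" for u v
    using that[unfolded arc_cases] edge by blast
  then have "arcs (with_proj T \<restriction> (pverts T - ?N)) = {}" by (auto simp: induce_subgraph_def)
  then show ?thesis using sub unfolding isolating_set_def D_def by blast
qed

lemma childless_is_leaf:
  assumes "v \<in> pverts T" "v \<noteq> r" "ch v = {}"
  shows "v \<in> leaves T"
proof -
  have "out_arcs (with_proj T) v = {(v, par v)}"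
    using assms by (auto simp: arc_cases children_def)
  then show ?thesis using assms by (simp add: leaves_def out_degree_def)
qed

text \<open>Among the vertices other than the root, one of maximal rank has no children.\<close>

lemma childless_exists:
  assumes "pverts T \<noteq> {r}"
  obtains v where "v \<in> pverts T" "v \<noteq> r" "ch v = {}"
proof -
  let ?A = "pverts T - {r}"
  have A: "finite ?A" "?A \<noteq> {}" using assms root pair_finite_verts by auto
  then have "Max (d ` ?A) \<in> d ` ?A" by (intro Max_in) auto
  then obtain v where v: "v \<in> ?A" "d v = Max (d ` ?A)" by (metis imageE)
  have "ch v = {}"
  proof (rule equals0I)
    fix c assume "c \<in> ch v"
    then have c: "c \<in> ?A" "par c = v" by (auto simp: children_def)
    then have "d c \<le> d v" using A v(2) by simp
    then show False using c par(2)[of c] by auto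
  qed
  then show thesis using v that by blast
qed

text \<open>
  Choosing an \<open>Open\<close> root costs \<open>4\<close> against its credit \<open>3\<close>. The root is a leaf that has a child, so
  it is not among the childless vertices and contributes the missing unit.
\<close>

lemma isolation_bound_leaf_root:
  assumes "r \<in> leaves T"
  shows "4 * isolation_number T \<le> graph_order T + leaf_order T"
proof -
  obtain s where s: "\<And>v. s v = label_from (s ` ch v)" using labelling_exists by blast
  let ?D = "if s r = Open then insert r (chosen T s) else chosen T s"
  have "isolation_number T \<le> card ?D"
    unfolding isolation_number_def using labelling_isolates[OF s] by (intro Least_le) blast
  \<comment> \<open>The root is added only when its credit is \<open>3\<close>.\<close>
  moreover have "4 * card ?D \<le> 4 * card (chosen T s) + credit (s r) + 1"
    using card_insert_le_m1 by (cases "s r") (auto simp: card_insert_if chosen_def pair_finite_verts)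
  moreover have "card {v \<in> pverts T. ch v = {}} + 1 \<le> leaf_order T"
  proof -
    have "card (out_arcs (with_proj T) r) = 1" using assms by (simp add: leaves_def out_degree_def)
    then obtain e where "out_arcs (with_proj T) r = {e}" by (rule card_1_singletonE)
    then have "e \<in> parcs T" "fst e = r" by (metis in_out_arcs_conv singletonI with_proj_simps)+
    then have "(r, snd e) \<in> parcs T" by (metis prod.collapse)
    then have "ch r \<noteq> {}" by (auto simp: arc_cases children_def)
    then have r: "r \<notin> {v \<in> pverts T. ch v = {}}" by simp
    have fin: "finite (leaves T)" by (simp add: leaves_def pair_finite_verts)
    have "insert r {v \<in> pverts T. ch v = {}} \<subseteq> leaves T"
      using assms childless_is_leaf r by blast
    from card_mono[OF fin this] show ?thesis
      using r pair_finite_verts by (simp add: leaf_order_def)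
  qed
  ultimately show ?thesis using labelling_bound[OF s] by (simp add: graph_order_def)
qed

end

text \<open>
  Rooting the tree anywhere yields a leaf, at which it is rooted again. The one-vertex tree has no
  leaf, but there the empty set is isolating.
\<close>

lemma isolation_number_tree:
  assumes "tree_graph T"
  shows "4 * isolation_number T \<le> graph_order T + leaf_order T"
proof -
  interpret pair_graph T using assms by (simp add: tree_graph_def)
  have conn: "connected (with_proj T)" and acyclic: "\<not> (\<exists>p. cycle p \<and> length p \<ge> 3)"
    using assms by (auto simp: tree_graph_def)
  have rooted: "\<exists>par d. rooted_tree T v par d" if "v \<in> pverts T" for v
    using acyclic_connected_imp_rooted[OF conn acyclic that]
    by (auto simp: rooted_tree_def rooted_tree_axioms_def)
  obtain r where r: "r \<in> pverts T" using conn by (auto simp: connected_def strongly_connected_def)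
  show ?thesis
  proof (cases "pverts T = {r}")
    case True
    then have "parcs T = {}" using in_arcsD1 in_arcsD2 no_loops' by fastforce
    then have "isolating_set T {}" by (simp add: isolating_set_def induce_subgraph_def)
    then have "isolation_number T \<le> card ({} :: 'a set)"
      unfolding isolation_number_def by (intro Least_le) blast
    then show ?thesis by simp
  next
    case False
    obtain par d where "rooted_tree T r par d" using rooted r by blast
    then obtain l where l: "l \<in> pverts T" "l \<in> leaves T"
      using False rooted_tree.childless_exists rooted_tree.childless_is_leaf by metis
    then obtain par d where "rooted_tree T l par d" using rooted by blast
    then show ?thesis using rooted_tree.isolation_bound_leaf_root l by metis
  qed
qed

section \<open>Paths attain the bound\<close>

definition path_graph :: "nat \<Rightarrow> nat pair_pre_digraph" where
  "path_graph n = \<lparr> pverts = {..<n}, parcs = {(i, j). i < n \<and> j < n \<and> (j = Suc i \<or> i = Suc j)} \<rparr>"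

lemma path_graph_sel [simp]:
  "pverts (path_graph n) = {..<n}"
  "(i, j) \<in> parcs (path_graph n) \<longleftrightarrow> i < n \<and> j < n \<and> (j = Suc i \<or> i = Suc j)"
  by (simp_all add: path_graph_def)

lemma pair_graph_path_graph: "pair_graph (path_graph n)"
proof
  show "finite (parcs (path_graph n))"
    by (rule finite_subset[of _ "{..<n} \<times> {..<n}"]) (auto simp: path_graph_def)
  show "symmetric (with_proj (path_graph n))"
    by (auto simp: symmetric_def sym_def)
qed (auto simp: path_graph_def)

lemma tree_graph_path_graph:
  assumes "n > 0"
  shows "tree_graph (path_graph n)"
proof -
  have "rooted_on (path_graph n) (pverts (path_graph n)) 0 (\<lambda>v. v - 1) (\<lambda>v. v)"
    using assms by (auto simp: rooted_on_def)
  then show ?thesis by (rule pair_graph.rooted_imp_tree[OF pair_graph_path_graph])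
qed

lemma leaf_order_path_graph:
  assumes "n \<ge> 2"
  shows "leaf_order (path_graph n) = 2"
proof -
  let ?G = "path_graph n"
  have out: "out_arcs (with_proj ?G) v = {e. fst e = v \<and> e \<in> parcs ?G}" for v by auto
  have "out_degree (with_proj ?G) v = 1 \<longleftrightarrow> v = 0 \<or> v = n - 1" if v: "v < n" for v
  proof -
    consider "v = 0" | "v = n - 1" "v \<noteq> 0" | "v \<noteq> 0" "Suc v < n" using v by linarith
    then show ?thesis
    proof cases
      case 1
      then have "out_arcs (with_proj ?G) v = {(v, Suc v)}" using assms unfolding out by auto
      then show ?thesis using 1 by (simp add: out_degree_def)
    next
      case 2
      then have "out_arcs (with_proj ?G) v = {(v, v - 1)}" using v unfolding out by auto
      then show ?thesis using 2 by (simp add: out_degree_def)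
    next
      case 3
      then have "out_arcs (with_proj ?G) v = {(v, v - 1), (v, Suc v)}" using v unfolding out by auto
      then show ?thesis using 3 by (simp add: out_degree_def)
    qed
  qed
  then have "leaves ?G = {0, n - 1}" using assms by (auto simp: leaves_def)
  then show ?thesis using assms by (simp add: leaf_order_def)
qed

text \<open>
  The edge from \<open>i\<close> to \<open>i + 1\<close> meets the closed neighbourhood of \<open>v\<close> only if \<open>i\<close> lies between \<open>v - 2\<close> and
  \<open>v + 1\<close>. So each vertex of \<open>D\<close> accounts for at most four of the \<open>n - 1\<close> edges.
\<close>

lemma isolating_set_path_graph:
  assumes "isolating_set (path_graph n) D"
  shows "n \<le> 4 * card D + 1"
proof -
  have D: "D \<subseteq> {..<n}" using assms by (simp add: isolating_set_def)
  then have fin: "finite D" using finite_subset by blast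
  have "i \<in> (\<Union>v\<in>D. {v - 2..v + 1})" if i: "Suc i < n" for i
  proof -
    let ?N = "closed_nbhd (path_graph n) D"
    have "i \<in> ?N \<or> Suc i \<in> ?N"
    proof (rule ccontr)
      assume "\<not> ?thesis"
      then have "(i, Suc i) \<in> arcs (with_proj (path_graph n) \<restriction> (pverts (path_graph n) - ?N))"
        using i by (simp add: induce_subgraph_def)
      then show False using assms unfolding isolating_set_def by blast
    qed
    then obtain v where "v \<in> D" "i \<le> v + 1" "v \<le> i + 2"
      by (fastforce simp: closed_nbhd_def)
    then show ?thesis by (intro UN_I[of v]) auto
  qed
  then have "{..<n - 1} \<subseteq> (\<Union>v\<in>D. {v - 2..v + 1})" by auto
  then have "n - 1 \<le> card (\<Union>v\<in>D. {v - 2..v + 1})"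
    using card_mono[of "\<Union>v\<in>D. {v - 2..v + 1}" "{..<n - 1}"] fin by simp
  also have "\<dots> \<le> (\<Sum>v\<in>D. card {v - 2..v + 1})" by (rule card_UN_le[OF fin])
  also have "\<dots> \<le> (\<Sum>v\<in>D. 4)" by (rule sum_mono) simp
  finally show ?thesis by simp
qed

lemma isolation_number_path_graph:
  "isolation_number (path_graph (4 * k + 2)) = Suc k"
proof (rule antisym)
  let ?G = "path_graph (4 * k + 2)"
  have "tree_graph ?G" "leaf_order ?G = 2" "graph_order ?G = 4 * k + 2"
    by (simp_all add: tree_graph_path_graph leaf_order_path_graph graph_order_def)
  then show "isolation_number ?G \<le> Suc k" using isolation_number_tree[of ?G] by simp
  \<comment> \<open>The whole vertex set is isolating, so the minimum is attained.\<close>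
  have "isolating_set ?G (pverts ?G)"
    by (simp add: isolating_set_def induce_subgraph_def closed_nbhd_def)
  then have "\<exists>D. isolating_set ?G D \<and> card D = isolation_number ?G"
    unfolding isolation_number_def
    by (intro LeastI_ex[where P = "\<lambda>k. \<exists>D. isolating_set ?G D \<and> card D = k"]) blast
  then obtain D where "isolating_set ?G D" "card D = isolation_number ?G" by blast
  then show "Suc k \<le> isolation_number ?G" using isolating_set_path_graph by fastforce
qed

theorem theorem3p1:
  shows "(\<forall>(T :: 'a pair_pre_digraph) n l.
            tree_graph T \<and> graph_order T = n \<and> leaf_order T = l \<longrightarrow>
              real (isolation_number T) \<le> (real n + real l) / 4) \<and>
         (\<forall>r::int. r \<ge> 1 \<longrightarrow>
            (\<exists>n l. \<exists>T :: nat pair_pre_digraph.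
               tree_graph T \<and> graph_order T = n \<and> leaf_order T = l \<and>
               real (isolation_number T) = (real n + real l) / 4 \<and>
               (real n + real l) / 4 = real_of_int r))"
proof (intro conjI allI impI)
  fix T :: "'a pair_pre_digraph" and n l
  assume "tree_graph T \<and> graph_order T = n \<and> leaf_order T = l"
  then have "real (4 * isolation_number T) \<le> real (n + l)"
    using isolation_number_tree[of T] by (simp only: of_nat_le_iff)
  then show "real (isolation_number T) \<le> (real n + real l) / 4" by simp
next
  fix r :: int
  assume r: "r \<ge> 1"
  define k where "k = nat (r - 1)"
  have rk: "real_of_int r = real k + 1" using r by (simp add: k_def)
  let ?T = "path_graph (4 * k + 2)"
  have "tree_graph ?T \<and> graph_order ?T = 4 * k + 2 \<and> leaf_order ?T = 2 \<and>
      real (isolation_number ?T) = (real (4 * k + 2) + real 2) / 4 \<and>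
      (real (4 * k + 2) + real 2) / 4 = real_of_int r"
    using isolation_number_path_graph[of k]
    by (simp add: tree_graph_path_graph leaf_order_path_graph graph_order_def rk add_divide_distrib)
  then show "\<exists>n l. \<exists>T :: nat pair_pre_digraph.
       tree_graph T \<and> graph_order T = n \<and> leaf_order T = l \<and>
       real (isolation_number T) = (real n + real l) / 4 \<and>
       (real n + real l) / 4 = real_of_int r" by blast
qed

end
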